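(* Let $n,K\ge 1$, let $\{B_0,\dots,B_{K-1}\}$ be a partition of $\mathbb{R}$ into pairwise disjoint measurable sets, let $A,B\in\mathbb{R}^n$, and let $\nu_A,\nu_B$ be the finite measures on $\Omega=\{1,\dots,n\}\times\{0,\dots,K-1\}$ induced by the multistate embeddings of $A$ and $B$. Put $M_A:=\nu_A(\Omega)=\|A\|_1$, $M_B:=\nu_B(\Omega)=\|B\|_1$, assume $M_A+M_B>0$, and let $$\mathrm{TV}(\nu_A,\nu_B):=\frac12\sum_{\omega\in\Omega}\bigl|\nu_A(\{\omega\})-\nu_B(\{\omega\})\bigr|.$$ Then $$J_{\text{peak}}(A,B)=\frac{M_A+M_B-2\,\mathrm{TV}(\nu_A,\nu_B)}{M_A+M_B+2\,\mathrm{TV}(\nu_A,\nu_B)},$$ and consequently $$d_{\text{peak}}(A,B)=1-J_{\text{peak}}(A,B)=\frac{4\,\mathrm{TV}(\nu_A,\nu_B)}{M_A+M_B+2\,\mathrm{TV}(\nu_A,\nu_B)}.$$ Equivalently, with the normalized discrepancy $$\delta(A,B):=\frac{\mathrm{TV}(\nu_A,\nu_B)}{\tfrac12(M_A+M_B)}\in[0,1],$$ one has $$J_{\text{peak}}(A,B)=\frac{1-\delta(A,B)}{1+\delta(A,B)},\qquad d_{\text{peak}}(A,B)=\frac{2\,\delta(A,B)}{1+\delta(A,B)}.$$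
   Context: $\|\cdot\|_1$ is the $\ell^1$ norm on $\mathbb{R}^n$. For $A=(A_1,\dots,A_n)\in\mathbb{R}^n$, the multistate embedding $\psi^{(K)}(A)\in\mathbb{R}_{\ge 0}^{n\times K}$ is $[\psi^{(K)}(A)]_{i,k}=|A_i|\cdot\mathbf{1}\{A_i\in B_k\}$, $i=1,\dots,n$, $k=0,\dots,K-1$. The measure $\nu_A$ on $\Omega$ (with the full power set as $\sigma$-algebra) is determined by $\nu_A(\{(i,k)\})=[\psi^{(K)}(A)]_{i,k}$; $\nu_B$ is defined in the same way from $B$. Here the peak-to-peak similarity is computed on the multistate embedding: $$J_{\text{peak}}(A,B)=\frac{\sum_{\omega\in\Omega}\min\{\nu_A(\{\omega\}),\nu_B(\{\omega\})\}}{\sum_{\omega\in\Omega}\max\{\nu_A(\{\omega\}),\nu_B(\{\omega\})\}},$$ and $d_{\text{peak}}(A,B)=1-J_{\text{peak}}(A,B)$. *)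

theory Defs
  imports "HOL-Analysis.Analysis"
begin

definition l1_norm :: "real ^ 'n \<Rightarrow> real" where
  "l1_norm A = (\<Sum>i\<in>UNIV. \<bar>A $ i\<bar>)"

(* "Measurable" is read as Lebesgue measurable, which includes every Borel set.
   Blocks may be empty. *)
definition measurable_partition :: "nat \<Rightarrow> (nat \<Rightarrow> real set) \<Rightarrow> bool" where
  "measurable_partition K P \<longleftrightarrow>
     (\<forall>k<K. P k \<in> sets lebesgue) \<and> disjoint_family_on P {..<K} \<and> (\<Union>k<K. P k) = UNIV"

(* The finite type 'n plays the role of {1,...,n}, so n = CARD('n). *)
definition Omega :: "nat \<Rightarrow> ('n::finite \<times> nat) set" where
  "Omega K = UNIV \<times> {..<K}"

(* The entries of the n x K matrix; only the columns k < K are meaningful. *)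
definition multistate_embedding :: "(nat \<Rightarrow> real set) \<Rightarrow> real ^ 'n \<Rightarrow> 'n \<Rightarrow> nat \<Rightarrow> real" where
  "multistate_embedding P A i k = \<bar>A $ i\<bar> * indicator (P k) (A $ i)"

definition multistate_measure ::
  "nat \<Rightarrow> (nat \<Rightarrow> real set) \<Rightarrow> real ^ 'n \<Rightarrow> ('n::finite \<times> nat) measure" where
  "multistate_measure K P A =
     point_measure (Omega K) (\<lambda>(i, k). ennreal (multistate_embedding P A i k))"

definition total_mass :: "nat \<Rightarrow> (nat \<Rightarrow> real set) \<Rightarrow> real ^ 'n \<Rightarrow> real" where
  "total_mass K P A = measure (multistate_measure K P A) (Omega K)"

definition TV :: "nat \<Rightarrow> ('n::finite \<times> nat) measure \<Rightarrow> ('n \<times> nat) measure \<Rightarrow> real" where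
  "TV K \<mu> \<nu> = 1 / 2 * (\<Sum>\<omega>\<in>Omega K. \<bar>measure \<mu> {\<omega>} - measure \<nu> {\<omega>}\<bar>)"

definition J_peak :: "nat \<Rightarrow> (nat \<Rightarrow> real set) \<Rightarrow> real ^ 'n \<Rightarrow> real ^ 'n \<Rightarrow> real" where
  "J_peak K P A B =
     (\<Sum>\<omega>\<in>Omega K. min (measure (multistate_measure K P A) {\<omega>}) (measure (multistate_measure K P B) {\<omega>})) /
     (\<Sum>\<omega>\<in>Omega K. max (measure (multistate_measure K P A) {\<omega>}) (measure (multistate_measure K P B) {\<omega>}))"

definition d_peak :: "nat \<Rightarrow> (nat \<Rightarrow> real set) \<Rightarrow> real ^ 'n \<Rightarrow> real ^ 'n \<Rightarrow> real" where
  "d_peak K P A B = 1 - J_peak K P A B"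

definition normalized_discrepancy ::
  "nat \<Rightarrow> (nat \<Rightarrow> real set) \<Rightarrow> real ^ 'n \<Rightarrow> real ^ 'n \<Rightarrow> real" where
  "normalized_discrepancy K P A B =
     TV K (multistate_measure K P A) (multistate_measure K P B) /
     (1 / 2 * (total_mass K P A + total_mass K P B))"

end

theory Submission
  imports Defs
begin

text \<open>Since 2 min(a, b) = a + b - |a - b| and 2 max(a, b) = a + b + |a - b|, summing over the
  point masses turns the numerator and the denominator of the peak-to-peak similarity into half of
  M_A + M_B - 2 TV and M_A + M_B + 2 TV. The bound TV \<le> (M_A + M_B) / 2 holds because the sum of
  the minima is nonnegative.\<close>

lemma finite_Omega [simp]: "finite (Omega K)"
  by (simp add: Omega_def)

lemma multistate_embedding_nonneg [simp]: "multistate_embedding P A i k \<ge> 0"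
  by (simp add: multistate_embedding_def)

text \<open>On the finite set \<open>Omega K\<close> a point measure is a finite sum of weights, and
  nonnegativity of the entries lets \<open>ennreal\<close> be pulled out of that sum.\<close>

lemma emeasure_multistate_measure:
  assumes "X \<subseteq> Omega K"
  shows "emeasure (multistate_measure K P A) X =
    ennreal (\<Sum>(i, k)\<in>X. multistate_embedding P A i k)"
  unfolding multistate_measure_def
  by (subst emeasure_point_measure_finite)
     (auto simp: assms case_prod_unfold intro!: sum_ennreal)

lemma measure_multistate_measure:
  assumes "X \<subseteq> Omega K"
  shows "measure (multistate_measure K P A) X = (\<Sum>(i, k)\<in>X. multistate_embedding P A i k)"
  by (simp add: measure_def emeasure_multistate_measure[OF assms] case_prod_unfold sum_nonneg)

lemma finite_measure_multistate_measure: "finite_measure (multistate_measure K P A)"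
proof
  have "space (multistate_measure K P A) = Omega K"
    by (simp add: multistate_measure_def space_point_measure)
  then show "emeasure (multistate_measure K P A) (space (multistate_measure K P A)) \<noteq> \<infinity>"
    by (simp add: emeasure_multistate_measure)
qed

text \<open>\<open>TV\<close> and \<open>J_peak\<close> are sums over point masses; additivity
  brings the total mass into the same form.\<close>

lemma total_mass_eq_sum_singletons:
  "total_mass K P A = (\<Sum>\<omega>\<in>Omega K. measure (multistate_measure K P A) {\<omega>})"
  by (auto simp: total_mass_def measure_multistate_measure intro!: sum.cong)

text \<open>The blocks partition the line, so exactly one of them contains \<open>A $ i\<close> and
  row \<open>i\<close> of the matrix carries its whole mass in that column.\<close>

lemma sum_multistate_embedding:
  assumes "measurable_partition K P"
  shows "(\<Sum>k<K. multistate_embedding P A i k) = \<bar>A $ i\<bar>"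
proof -
  have "(\<Sum>k<K. indicator (P k) (A $ i)) = (indicator (\<Union>k<K. P k) (A $ i) :: real)"
    using assms by (intro indicator_UN_disjoint [symmetric]) (auto simp: measurable_partition_def)
  also have "\<dots> = 1"
    using assms by (simp add: measurable_partition_def)
  finally show ?thesis
    by (simp add: multistate_embedding_def flip: sum_distrib_left)
qed

lemma total_mass_eq_l1_norm:
  assumes "measurable_partition K P"
  shows "total_mass K P A = l1_norm A"
proof -
  have "total_mass K P A = (\<Sum>i\<in>UNIV. \<Sum>k<K. multistate_embedding P A i k)"
    \<comment> \<open>The sum formula is applied while the set is still \<open>Omega K\<close>; only
      then is the set unfolded into a product, to match the iterated sum.\<close>
    by (simp add: total_mass_def measure_multistate_measure)
       (simp add: Omega_def sum.cartesian_product)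
  then show ?thesis
    by (simp add: sum_multistate_embedding[OF assms] l1_norm_def)
qed

lemma sum_min_eq:
  fixes f g :: "'a \<Rightarrow> real"
  shows "(\<Sum>x\<in>S. min (f x) (g x)) = (sum f S + sum g S - (\<Sum>x\<in>S. \<bar>f x - g x\<bar>)) / 2"
proof -
  have "(\<Sum>x\<in>S. min (f x) (g x)) = (\<Sum>x\<in>S. (f x + g x - \<bar>f x - g x\<bar>) / 2)"
    by (intro sum.cong) auto
  then show ?thesis
    by (simp add: sum.distrib sum_subtractf flip: sum_divide_distrib)
qed

lemma sum_max_eq:
  fixes f g :: "'a \<Rightarrow> real"
  shows "(\<Sum>x\<in>S. max (f x) (g x)) = (sum f S + sum g S + (\<Sum>x\<in>S. \<bar>f x - g x\<bar>)) / 2"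
proof -
  have "(\<Sum>x\<in>S. max (f x) (g x)) = (\<Sum>x\<in>S. (f x + g x + \<bar>f x - g x\<bar>) / 2)"
    by (intro sum.cong) auto
  then show ?thesis
    by (simp add: sum.distrib flip: sum_divide_distrib)
qed

lemma TV_nonneg: "TV K \<mu> \<nu> \<ge> 0"
  by (simp add: TV_def sum_nonneg)

lemma TV_le_total_mass:
  "2 * TV K (multistate_measure K P A) (multistate_measure K P B)
    \<le> total_mass K P A + total_mass K P B"
proof -
  have "0 \<le> (\<Sum>\<omega>\<in>Omega K. min (measure (multistate_measure K P A) {\<omega>})
                             (measure (multistate_measure K P B) {\<omega>}))"
    by (intro sum_nonneg) simp
  then show ?thesis
    by (simp add: sum_min_eq TV_def total_mass_eq_sum_singletons)
qed

lemma J_peak_eq: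
  "J_peak K P A B =
    (total_mass K P A + total_mass K P B
      - 2 * TV K (multistate_measure K P A) (multistate_measure K P B)) /
    (total_mass K P A + total_mass K P B
      + 2 * TV K (multistate_measure K P A) (multistate_measure K P B))"
proof -
  \<comment> \<open>The factors 1/2 from the sums of minima and maxima cancel. For
    \<open>b = 0\<close> both sides are \<open>0\<close>, by the convention
    \<open>x / 0 = 0\<close>.\<close>
  have halves: "(a / 2) / (b / 2) = a / b" for a b :: real
    by simp
  show ?thesis
    unfolding J_peak_def sum_min_eq sum_max_eq halves
    by (simp add: TV_def total_mass_eq_sum_singletons)
qed

theorem proposition4p12:
  fixes K :: nat and P :: "nat \<Rightarrow> real set" and A B :: "real ^ 'n"
  assumes "K \<ge> 1"
    and "measurable_partition K P"
    and "total_mass K P A + total_mass K P B > 0"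
  shows "let \<nu>A = multistate_measure K P A; \<nu>B = multistate_measure K P B;
             MA = total_mass K P A; MB = total_mass K P B;
             T = TV K \<nu>A \<nu>B; \<delta> = normalized_discrepancy K P A B;
             J = J_peak K P A B; d = d_peak K P A B
         in finite_measure \<nu>A \<and> finite_measure \<nu>B
          \<and> MA = l1_norm A \<and> MB = l1_norm B
          \<and> J = (MA + MB - 2 * T) / (MA + MB + 2 * T)
          \<and> d = 1 - J
          \<and> d = 4 * T / (MA + MB + 2 * T)
          \<and> \<delta> \<in> {0..1}
          \<and> J = (1 - \<delta>) / (1 + \<delta>)
          \<and> d = 2 * \<delta> / (1 + \<delta>)"
proof -
  define S where "S = total_mass K P A + total_mass K P B"
  define T where "T = TV K (multistate_measure K P A) (multistate_measure K P B)"
  define \<delta> where "\<delta> = normalized_discrepancy K P A B"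
  have S: "S > 0" and T: "0 \<le> T" "2 * T \<le> S"
    using assms(3) TV_nonneg TV_le_total_mass by (auto simp: S_def T_def)
  have \<delta>_eq: "\<delta> = 2 * T / S"
    by (simp add: \<delta>_def normalized_discrepancy_def S_def T_def)
  \<comment> \<open>Numerator and denominator of the formula for \<open>J_peak\<close>, each divided
    by \<open>S\<close>; the common factor cancels in the quotient.\<close>
  have \<delta>_shift: "1 - \<delta> = (S - 2 * T) / S" "1 + \<delta> = (S + 2 * T) / S"
    using S by (simp_all add: \<delta>_eq field_simps)
  have \<delta>: "\<delta> \<in> {0..1}"
    using S T by (simp add: \<delta>_eq)
  have J: "J_peak K P A B = (S - 2 * T) / (S + 2 * T)"
    by (simp add: J_peak_eq S_def T_def)
  have d: "d_peak K P A B = 4 * T / (S + 2 * T)"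
    using S T by (simp add: d_peak_def J field_simps)
  have J\<delta>: "J_peak K P A B = (1 - \<delta>) / (1 + \<delta>)"
    using S by (simp add: J \<delta>_shift)
  have d\<delta>: "d_peak K P A B = 2 * \<delta> / (1 + \<delta>)"
    \<comment> \<open>The denominator is rewritten while it still has the form
      \<open>1 + \<delta>\<close>; the \<delta> left in the numerator is expanded
      afterwards.\<close>
    using S by (simp add: d \<delta>_shift) (simp add: \<delta>_eq)
  show ?thesis
    using finite_measure_multistate_measure total_mass_eq_l1_norm[OF assms(2)]
      J d \<delta> J\<delta> d\<delta>
    \<comment> \<open>\<open>d_peak_def\<close> settles the conjunct \<open>d = 1 - J\<close>; the
      chained facts settle the others.\<close>
    unfolding Let_def S_def T_def \<delta>_def by (intro conjI d_peak_def) assumption+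
qed

end
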